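(* Let $f:A\to B$ and $g:A\to C$ be ring homomorphisms, and let $J$ be an ideal of $B$ and $J'$ an ideal of $C$ such that $I_o:=f^{-1}(J)=g^{-1}(J')$. \begin{enumerate} \item $A\bowtie^{f,g}(J,J')$ is local if and only if $J\neq B$ and both $f(A)+J$ and $g(A)+J'$ are local. Moreover, in this case, the maximal ideal of $A\bowtie^{f,g}(J,J')$ has the form $\mathfrak m\bowtie^{f,g}(J,J')$, where $\mathfrak m$ is the unique maximal ideal of $A$ containing $I_o$. \item Suppose that $A$ is local. Then $A\bowtie^{f,g}(J,J')$ is local if and only if $J\times J'\subseteq\operatorname{Jac}(B\times C)$. \end{enumerate}
   Context: All rings are commutative with unity and nonzero ($1\neq0$), and ring homomorphisms are unital. A ring is local if it has exactly one maximal ideal (it need not be Noetherian). $\operatorname{Jac}(R)$ denotes the Jacobson radical of $R$. The bi-amalgamation of $A$ with $(B,C)$ along $(J,J')$ with respect to $(f,g)$ is the subring of $B\times C$ $$A\bowtie^{f,g}(J,J'):=\{(f(a)+j,\,g(a)+j')\mid a\in A,\ (j,j')\in J\times J'\}.$$ Here $f(A)+J=\{f(a)+j\mid a\in A, j\in J\}$ is a subring of $B$ and $g(A)+J'$ is a subring of $C$ (defined analogously). For an ideal $I$ of $A$, $$I\bowtie^{f,g}(J,J'):=\{(f(i)+j,\,g(i)+j')\mid i\in I,\ (j,j')\in J\times J'\},$$ which is an ideal of $A\bowtie^{f,g}(J,J')$. *)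

theory Defs
  imports "HOL-Algebra.Algebra"
begin

text \<open>Rings are required to be commutative; a local ring need not be Noetherian. The zero ring
  has no maximal ideal and is therefore not local.\<close>

definition local_ring :: "('a, 'm) ring_scheme \<Rightarrow> bool" where
  "local_ring R \<longleftrightarrow> cring R \<and> (\<exists>!M. maximalideal M R)"

text \<open>The carrier is intersected in so that the definition is also sensible for a ring without
  maximal ideals.\<close>

definition jacobson_radical :: "('a, 'm) ring_scheme \<Rightarrow> 'a set" where
  "jacobson_radical R = carrier R \<inter> \<Inter> {M. maximalideal M R}"

text \<open>For an ideal \<open>I\<close> of the domain of \<open>f\<close> and \<open>g\<close>, the following is the ideal
  \<open>I \<bowtie>\<^sup>f\<^sup>,\<^sup>g (J,J')\<close>; for \<open>I\<close> the whole domain, it is the carrier of the bi-amalgamation.\<close>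

definition bi_amalg_set ::
  "('b, 'm) ring_scheme \<Rightarrow> ('c, 'n) ring_scheme \<Rightarrow> ('a \<Rightarrow> 'b) \<Rightarrow> ('a \<Rightarrow> 'c)
    \<Rightarrow> 'b set \<Rightarrow> 'c set \<Rightarrow> 'a set \<Rightarrow> ('b \<times> 'c) set" where
  "bi_amalg_set B C f g J J' I =
    {(f i \<oplus>\<^bsub>B\<^esub> j, g i \<oplus>\<^bsub>C\<^esub> j') | i j j'. i \<in> I \<and> j \<in> J \<and> j' \<in> J'}"

definition bi_amalg ::
  "('a, 'k) ring_scheme \<Rightarrow> ('b, 'm) ring_scheme \<Rightarrow> ('c, 'n) ring_scheme
    \<Rightarrow> ('a \<Rightarrow> 'b) \<Rightarrow> ('a \<Rightarrow> 'c) \<Rightarrow> 'b set \<Rightarrow> 'c set \<Rightarrow> ('b \<times> 'c) ring" where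
  "bi_amalg A B C f g J J' =
    (RDirProd B C)\<lparr>carrier := bi_amalg_set B C f g J J' (carrier A)\<rparr>"

text \<open>The subring \<open>f(A) + J\<close> of \<open>B\<close>.\<close>

definition image_plus_ideal ::
  "('a, 'k) ring_scheme \<Rightarrow> ('b, 'm) ring_scheme \<Rightarrow> ('a \<Rightarrow> 'b) \<Rightarrow> 'b set
    \<Rightarrow> ('b, 'm) ring_scheme" where
  "image_plus_ideal A B f J = B\<lparr>carrier := f ` carrier A <+>\<^bsub>B\<^esub> J\<rparr>"

lemma RDirProd_simps:
  "carrier (RDirProd R S) = carrier R \<times> carrier S"
  "\<zero>\<^bsub>RDirProd R S\<^esub> = (\<zero>\<^bsub>R\<^esub>, \<zero>\<^bsub>S\<^esub>)"
  "\<one>\<^bsub>RDirProd R S\<^esub> = (\<one>\<^bsub>R\<^esub>, \<one>\<^bsub>S\<^esub>)"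
  "(a, b) \<oplus>\<^bsub>RDirProd R S\<^esub> (c, d) = (a \<oplus>\<^bsub>R\<^esub> c, b \<oplus>\<^bsub>S\<^esub> d)"
  "(a, b) \<otimes>\<^bsub>RDirProd R S\<^esub> (c, d) = (a \<otimes>\<^bsub>R\<^esub> c, b \<otimes>\<^bsub>S\<^esub> d)"
  by (auto simp: RDirProd_def DirProd_def monoid.defs)

lemma RDirProd_cring:
  assumes "cring R" "cring S"
  shows "cring (RDirProd R S)"
proof -
  interpret R: cring R by fact
  interpret S: cring S by fact
  interpret P: ring "RDirProd R S" by (rule RDirProd_ring) unfold_locales
  show ?thesis
    by unfold_locales (auto simp: RDirProd_simps R.m_comm S.m_comm)
qed

lemma RDirProd_minus:
  assumes "ring R" "ring S" "a \<in> carrier R" "b \<in> carrier S"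
  shows "\<ominus>\<^bsub>RDirProd R S\<^esub> (a, b) = (\<ominus>\<^bsub>R\<^esub> a, \<ominus>\<^bsub>S\<^esub> b)"
proof -
  interpret R: ring R by fact
  interpret S: ring S by fact
  interpret P: ring "RDirProd R S" by (rule RDirProd_ring) unfold_locales
  show ?thesis
    by (rule P.minus_equality) (use assms in \<open>auto simp: RDirProd_simps R.l_neg S.l_neg\<close>)
qed

lemma hom_plus_ideal_ops:
  assumes "cring A" "cring B" "f \<in> ring_hom A B" "ideal J B"
    and "a \<in> carrier A" "b \<in> carrier A" "j \<in> J" "k \<in> J"
  shows "\<exists>l\<in>J. (f a \<oplus>\<^bsub>B\<^esub> j) \<oplus>\<^bsub>B\<^esub> (f b \<oplus>\<^bsub>B\<^esub> k) = f (a \<oplus>\<^bsub>A\<^esub> b) \<oplus>\<^bsub>B\<^esub> l"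
    and "\<exists>l\<in>J. (f a \<oplus>\<^bsub>B\<^esub> j) \<otimes>\<^bsub>B\<^esub> (f b \<oplus>\<^bsub>B\<^esub> k) = f (a \<otimes>\<^bsub>A\<^esub> b) \<oplus>\<^bsub>B\<^esub> l"
    and "\<exists>l\<in>J. \<ominus>\<^bsub>B\<^esub> (f a \<oplus>\<^bsub>B\<^esub> j) = f (\<ominus>\<^bsub>A\<^esub> a) \<oplus>\<^bsub>B\<^esub> l"
    and "f a \<oplus>\<^bsub>B\<^esub> j \<in> carrier B"
proof -
  interpret A: cring A by fact
  interpret B: cring B by fact
  interpret J: ideal J B by fact
  interpret f: ring_hom_ring A B f
    by (rule ring_hom_ringI2) (use assms A.ring_axioms B.ring_axioms in auto)
  have jk: "j \<in> carrier B" "k \<in> carrier B" using assms(7,8) J.Icarr by auto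
  have fa: "f a \<in> carrier B" "f b \<in> carrier B" using assms(5,6) by auto
  show "f a \<oplus>\<^bsub>B\<^esub> j \<in> carrier B" using jk fa by auto
  show "\<exists>l\<in>J. (f a \<oplus>\<^bsub>B\<^esub> j) \<oplus>\<^bsub>B\<^esub> (f b \<oplus>\<^bsub>B\<^esub> k) = f (a \<oplus>\<^bsub>A\<^esub> b) \<oplus>\<^bsub>B\<^esub> l"
    by (rule bexI[of _ "j \<oplus>\<^bsub>B\<^esub> k"])
      (use assms(5-8) jk fa in \<open>simp_all add: f.hom_add B.a_assoc B.a_lcomm[of j] J.a_closed\<close>)
  show "\<exists>l\<in>J. \<ominus>\<^bsub>B\<^esub> (f a \<oplus>\<^bsub>B\<^esub> j) = f (\<ominus>\<^bsub>A\<^esub> a) \<oplus>\<^bsub>B\<^esub> l"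
    by (rule bexI[of _ "\<ominus>\<^bsub>B\<^esub> j"])
      (use assms(5-8) jk fa in \<open>simp_all add: B.minus_add J.a_inv_closed\<close>)
  show "\<exists>l\<in>J. (f a \<oplus>\<^bsub>B\<^esub> j) \<otimes>\<^bsub>B\<^esub> (f b \<oplus>\<^bsub>B\<^esub> k) = f (a \<otimes>\<^bsub>A\<^esub> b) \<oplus>\<^bsub>B\<^esub> l"
  proof (rule bexI[of _ "f a \<otimes>\<^bsub>B\<^esub> k \<oplus>\<^bsub>B\<^esub> j \<otimes>\<^bsub>B\<^esub> (f b \<oplus>\<^bsub>B\<^esub> k)"])
    show "f a \<otimes>\<^bsub>B\<^esub> k \<oplus>\<^bsub>B\<^esub> j \<otimes>\<^bsub>B\<^esub> (f b \<oplus>\<^bsub>B\<^esub> k) \<in> J"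
      using assms(7,8) jk fa by (intro J.a_closed J.I_l_closed J.I_r_closed) auto
    show "(f a \<oplus>\<^bsub>B\<^esub> j) \<otimes>\<^bsub>B\<^esub> (f b \<oplus>\<^bsub>B\<^esub> k)
        = f (a \<otimes>\<^bsub>A\<^esub> b) \<oplus>\<^bsub>B\<^esub> (f a \<otimes>\<^bsub>B\<^esub> k \<oplus>\<^bsub>B\<^esub> j \<otimes>\<^bsub>B\<^esub> (f b \<oplus>\<^bsub>B\<^esub> k))"
      using assms(5,6) jk fa by (simp add: B.l_distr B.r_distr B.a_ac)
  qed
qed

lemma image_plus_ideal_cring:
  assumes "cring A" "cring B" "f \<in> ring_hom A B" "ideal J B"
  shows "subcring (f ` carrier A <+>\<^bsub>B\<^esub> J) B" "cring (image_plus_ideal A B f J)"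
proof -
  interpret A: cring A by fact
  interpret B: cring B by fact
  interpret J: ideal J B by fact
  note ops = hom_plus_ideal_ops[OF assms]
  have mem: "x \<in> f ` carrier A <+>\<^bsub>B\<^esub> J \<longleftrightarrow> (\<exists>a\<in>carrier A. \<exists>j\<in>J. x = f a \<oplus>\<^bsub>B\<^esub> j)" for x
    unfolding set_add_def' by blast
  have "subring (f ` carrier A <+>\<^bsub>B\<^esub> J) B"
  proof (rule B.subringI)
    show "f ` carrier A <+>\<^bsub>B\<^esub> J \<subseteq> carrier B"
    proof
      fix x assume "x \<in> f ` carrier A <+>\<^bsub>B\<^esub> J"
      then obtain a j where x: "a \<in> carrier A" "j \<in> J" "x = f a \<oplus>\<^bsub>B\<^esub> j" unfolding mem by blast
      show "x \<in> carrier B" using ops(4)[OF x(1,1,2,2)] unfolding x(3) .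
    qed
    have "\<one>\<^bsub>B\<^esub> = f \<one>\<^bsub>A\<^esub> \<oplus>\<^bsub>B\<^esub> \<zero>\<^bsub>B\<^esub>" using ring_hom_one[OF assms(3)] by simp
    then show "\<one>\<^bsub>B\<^esub> \<in> f ` carrier A <+>\<^bsub>B\<^esub> J" unfolding mem using J.zero_closed by blast
  next
    fix x assume "x \<in> f ` carrier A <+>\<^bsub>B\<^esub> J"
    then obtain a j where x: "a \<in> carrier A" "j \<in> J" "x = f a \<oplus>\<^bsub>B\<^esub> j" unfolding mem by blast
    show "\<ominus>\<^bsub>B\<^esub> x \<in> f ` carrier A <+>\<^bsub>B\<^esub> J"
      using ops(3)[OF x(1,1,2,2)] A.a_inv_closed[OF x(1)] unfolding mem x(3) by blast
  next
    fix x y assume "x \<in> f ` carrier A <+>\<^bsub>B\<^esub> J" "y \<in> f ` carrier A <+>\<^bsub>B\<^esub> J"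
    then obtain a j b k where x: "a \<in> carrier A" "j \<in> J" "x = f a \<oplus>\<^bsub>B\<^esub> j"
      and y: "b \<in> carrier A" "k \<in> J" "y = f b \<oplus>\<^bsub>B\<^esub> k" unfolding mem by blast
    show "x \<otimes>\<^bsub>B\<^esub> y \<in> f ` carrier A <+>\<^bsub>B\<^esub> J"
      using ops(2)[OF x(1) y(1) x(2) y(2)] A.m_closed[OF x(1) y(1)] unfolding mem x(3) y(3) by blast
    show "x \<oplus>\<^bsub>B\<^esub> y \<in> f ` carrier A <+>\<^bsub>B\<^esub> J"
      using ops(1)[OF x(1) y(1) x(2) y(2)] A.a_closed[OF x(1) y(1)] unfolding mem x(3) y(3) by blast
  qed
  then show *: "subcring (f ` carrier A <+>\<^bsub>B\<^esub> J) B" by (rule B.subcringI')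
  then show "cring (image_plus_ideal A B f J)"
    unfolding image_plus_ideal_def using B.subcring_iff subcringE(1) by blast
qed

lemma bi_amalg_cring:
  assumes "cring A" "cring B" "cring C"
    and f: "f \<in> ring_hom A B" and g: "g \<in> ring_hom A C"
    and "ideal J B" "ideal J' C"
  shows "subcring (bi_amalg_set B C f g J J' (carrier A)) (RDirProd B C)"
    and "cring (bi_amalg A B C f g J J')"
proof -
  interpret A: cring A by fact
  interpret B: cring B by fact
  interpret C: cring C by fact
  interpret J: ideal J B by fact
  interpret J': ideal J' C by fact
  interpret P: cring "RDirProd B C" by (rule RDirProd_cring) unfold_locales
  note F = hom_plus_ideal_ops[OF assms(1,2) f assms(6)]
  note G = hom_plus_ideal_ops[OF assms(1,3) g assms(7)]
  let ?S = "bi_amalg_set B C f g J J' (carrier A)"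
  have mem: "x \<in> ?S \<longleftrightarrow>
    (\<exists>a\<in>carrier A. \<exists>j\<in>J. \<exists>j'\<in>J'. x = (f a \<oplus>\<^bsub>B\<^esub> j, g a \<oplus>\<^bsub>C\<^esub> j'))" for x
    unfolding bi_amalg_set_def by blast
  have "subring ?S (RDirProd B C)"
  proof (rule P.subringI)
    show "?S \<subseteq> carrier (RDirProd B C)"
      using F(4) G(4) by (auto simp: mem RDirProd_simps)
    have "\<one>\<^bsub>RDirProd B C\<^esub> = (f \<one>\<^bsub>A\<^esub> \<oplus>\<^bsub>B\<^esub> \<zero>\<^bsub>B\<^esub>, g \<one>\<^bsub>A\<^esub> \<oplus>\<^bsub>C\<^esub> \<zero>\<^bsub>C\<^esub>)"
      using ring_hom_one[OF f] ring_hom_one[OF g] by (simp add: RDirProd_simps)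
    then show "\<one>\<^bsub>RDirProd B C\<^esub> \<in> ?S"
      unfolding mem using J.zero_closed J'.zero_closed by blast
  next
    fix x assume "x \<in> ?S"
    then obtain a j j' where x: "a \<in> carrier A" "j \<in> J" "j' \<in> J'"
      "x = (f a \<oplus>\<^bsub>B\<^esub> j, g a \<oplus>\<^bsub>C\<^esub> j')" unfolding mem by blast
    have "\<ominus>\<^bsub>RDirProd B C\<^esub> x = (\<ominus>\<^bsub>B\<^esub> (f a \<oplus>\<^bsub>B\<^esub> j), \<ominus>\<^bsub>C\<^esub> (g a \<oplus>\<^bsub>C\<^esub> j'))"
      unfolding x(4) using x F(4) G(4) B.ring_axioms C.ring_axioms by (intro RDirProd_minus) auto
    then show "\<ominus>\<^bsub>RDirProd B C\<^esub> x \<in> ?S"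
      using F(3)[OF x(1,1,2,2)] G(3)[OF x(1,1,3,3)] A.a_inv_closed[OF x(1)]
      unfolding mem by metis
  next
    fix x y assume "x \<in> ?S" "y \<in> ?S"
    then obtain a j j' b k k' where x: "a \<in> carrier A" "j \<in> J" "j' \<in> J'"
      "x = (f a \<oplus>\<^bsub>B\<^esub> j, g a \<oplus>\<^bsub>C\<^esub> j')" and y: "b \<in> carrier A" "k \<in> J" "k' \<in> J'"
      "y = (f b \<oplus>\<^bsub>B\<^esub> k, g b \<oplus>\<^bsub>C\<^esub> k')" unfolding mem by blast
    show "x \<oplus>\<^bsub>RDirProd B C\<^esub> y \<in> ?S"
      using F(1)[OF x(1) y(1) x(2) y(2)] G(1)[OF x(1) y(1) x(3) y(3)] A.a_closed[OF x(1) y(1)]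
      unfolding mem x(4) y(4) RDirProd_simps by metis
    show "x \<otimes>\<^bsub>RDirProd B C\<^esub> y \<in> ?S"
      using F(2)[OF x(1) y(1) x(2) y(2)] G(2)[OF x(1) y(1) x(3) y(3)] A.m_closed[OF x(1) y(1)]
      unfolding mem x(4) y(4) RDirProd_simps by metis
  qed
  then show *: "subcring ?S (RDirProd B C)" by (rule P.subcringI')
  then show "cring (bi_amalg A B C f g J J')"
    unfolding bi_amalg_def using P.subcring_iff subcringE(1) by blast
qed

end

theory Submission
  imports Defs
begin

text \<open>A commutative ring is local iff it is nonzero and for every \<open>x\<close> one of \<open>x\<close> and \<open>1 - x\<close> is a unit.
  Hence locality can be tested along a surjection \<open>R \<rightarrow> S\<close> with \<open>S\<close> nonzero: \<open>R\<close> is local iff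
  \<open>S\<close> is local and \<open>1 + k\<close> is a unit for every \<open>k\<close> in the kernel. The projection of the
  bi-amalgamation onto \<open>f(A) + J\<close> has kernel \<open>0 \<times> J'\<close>, so the bi-amalgamation is local iff
  \<open>f(A) + J\<close> is local and \<open>1 + J'\<close> consists of units of \<open>C\<close>; the latter is automatic when \<open>J'\<close> is a
  proper ideal of a local ring \<open>g(A) + J'\<close>, and says that \<open>J'\<close> lies in the Jacobson radical. In the
  local case, an element with first entry in \<open>f(a) + J\<close> is a unit iff \<open>a\<close> is invertible
  modulo \<open>I\<^sub>o\<close>, which identifies the maximal ideal of nonunits.\<close>

section \<open>Maximal ideals, units and locality in a commutative ring\<close>

context cring
begin

text \<open>An elementwise form of "\<open>R / M\<close> is a field", which avoids the quotient
  ring. For \<open>a\<close> outside \<open>M\<close> the ideal \<open>M + (a)\<close> is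
  everything, so \<open>1 = m + b a\<close>. Conversely, an ideal above \<open>M\<close> that
  contains such an \<open>a\<close> contains \<open>(1 - a b) + a b = 1\<close>.\<close>

lemma maximalideal_iff:
  "maximalideal M R \<longleftrightarrow>
    ideal M R \<and> \<one> \<notin> M \<and> (\<forall>a\<in>carrier R - M. \<exists>b\<in>carrier R. \<one> \<ominus> a \<otimes> b \<in> M)"
proof
  assume M: "maximalideal M R"
  interpret M: maximalideal M R by fact
  have one: "\<one> \<notin> M" using M.one_imp_carrier M.I_notcarr by blast
  have "\<exists>b\<in>carrier R. \<one> \<ominus> a \<otimes> b \<in> M" if a: "a \<in> carrier R" "a \<notin> M" for a
  proof -
    have id: "ideal (M <+> PIdl a) R"
      by (rule add_ideals[OF M.is_ideal cgenideal_ideal[OF a(1)]])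
    have mem: "x \<in> M <+> PIdl a \<longleftrightarrow> (\<exists>m\<in>M. \<exists>b\<in>carrier R. x = m \<oplus> b \<otimes> a)" for x
      by (auto simp: set_add_def' cgenideal_def)
    have "M \<subseteq> M <+> PIdl a"
    proof
      fix m assume m: "m \<in> M"
      then have "m = m \<oplus> \<zero> \<otimes> a" using a M.Icarr by simp
      then show "m \<in> M <+> PIdl a" unfolding mem using m zero_closed by blast
    qed
    moreover have "a \<in> M <+> PIdl a"
    proof -
      have "a = \<zero> \<oplus> \<one> \<otimes> a" using a by simp
      then show ?thesis unfolding mem using M.zero_closed one_closed by blast
    qed
    ultimately have "M <+> PIdl a = carrier R"
      using M.I_maximal[OF id] a(2) ideal.Icarr[OF id] by blast
    then have "\<one> \<in> M <+> PIdl a" by simp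
    then obtain m b where mb: "m \<in> M" "b \<in> carrier R" "\<one> = m \<oplus> b \<otimes> a" unfolding mem by blast
    then have "\<one> \<ominus> a \<otimes> b = m"
      using a M.Icarr[OF mb(1)] by (simp add: a_minus_def m_comm[of a b] a_assoc r_neg)
    then show ?thesis using mb by blast
  qed
  then show "ideal M R \<and> \<one> \<notin> M \<and> (\<forall>a\<in>carrier R - M. \<exists>b\<in>carrier R. \<one> \<ominus> a \<otimes> b \<in> M)"
    using one M.is_ideal by blast
next
  assume *: "ideal M R \<and> \<one> \<notin> M \<and> (\<forall>a\<in>carrier R - M. \<exists>b\<in>carrier R. \<one> \<ominus> a \<otimes> b \<in> M)"
  then interpret M: ideal M R by blast
  show "maximalideal M R"
  proof (rule maximalidealI[OF M.is_ideal])
    show "carrier R \<noteq> M" using * by blast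
    fix K assume K: "ideal K R" "M \<subseteq> K" "K \<subseteq> carrier R"
    interpret K: ideal K R by fact
    show "K = M \<or> K = carrier R"
    proof (cases "K \<subseteq> M")
      case False
      then obtain a where a: "a \<in> K" "a \<notin> M" by blast
      then have ac: "a \<in> carrier R" using K by blast
      then obtain b where b: "b \<in> carrier R" "\<one> \<ominus> a \<otimes> b \<in> M" using * a by blast
      have "(\<one> \<ominus> a \<otimes> b) \<oplus> a \<otimes> b \<in> K"
        using K.I_r_closed[OF a(1) b(1)] b K(2) by (intro K.a_closed) auto
      moreover have "(\<one> \<ominus> a \<otimes> b) \<oplus> a \<otimes> b = \<one>"
        using ac b by (simp add: a_minus_def a_assoc l_neg)
      ultimately show ?thesis using K.one_imp_carrier by simp
    qed (use K in blast)
  qed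
qed

text \<open>Zorn's lemma on the ideals that contain \<open>I\<close> and avoid \<open>1\<close>;
  both conditions survive unions of nonempty chains.\<close>

lemma ideal_subset_maximalideal:
  assumes "ideal I R" "\<one> \<notin> I"
  obtains M where "maximalideal M R" "I \<subseteq> M"
proof -
  let ?A = "{K. ideal K R \<and> I \<subseteq> K \<and> \<one> \<notin> K}"
  have "\<exists>M\<in>?A. \<forall>K\<in>?A. M \<subseteq> K \<longrightarrow> K = M"
  proof (rule subset_Zorn_nonempty)
    show "?A \<noteq> {}" using assms by blast
    fix \<C> assume C: "\<C> \<noteq> {}" "subset.chain ?A \<C>"
    then have "subset.chain {I. ideal I R} \<C>" unfolding pred_on.chain_def by blast
    from chain_Union_is_ideal[OF this] have "ideal (\<Union>\<C>) R" using C(1) by simp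
    then show "\<Union>\<C> \<in> ?A" using C unfolding pred_on.chain_def by blast
  qed
  then obtain M where M: "ideal M R" "I \<subseteq> M" "\<one> \<notin> M"
    and max: "\<And>K. ideal K R \<Longrightarrow> I \<subseteq> K \<Longrightarrow> \<one> \<notin> K \<Longrightarrow> M \<subseteq> K \<Longrightarrow> K = M" by auto
  have "maximalideal M R"
  proof (rule maximalidealI[OF M(1)])
    show "carrier R \<noteq> M" using M(3) by blast
    fix K assume "ideal K R" "M \<subseteq> K" "K \<subseteq> carrier R"
    then show "K = M \<or> K = carrier R"
      using max[of K] M(2) ideal.one_imp_carrier[of K R] by blast
  qed
  then show thesis using that M(2) by blast
qed

lemma Units_iff: "x \<in> Units R \<longleftrightarrow> x \<in> carrier R \<and> (\<exists>y\<in>carrier R. x \<otimes> y = \<one>)"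
  unfolding Units_def using m_comm by auto

lemma ideal_Units:
  assumes "ideal I R" "x \<in> I" "x \<in> Units R"
  shows "\<one> \<in> I"
  using assms ideal.I_r_closed[OF assms(1,2)] unfolding Units_iff by metis

lemma nonunit_in_maximalideal:
  assumes "x \<in> carrier R" "x \<notin> Units R"
  obtains M where "maximalideal M R" "x \<in> M"
proof -
  \<comment> \<open>If \<open>1\<close> were a multiple of \<open>x\<close>, then \<open>x\<close>
    would be a unit; so the principal ideal is proper.\<close>
  have "\<one> \<notin> PIdl x"
    using assms m_comm[OF assms(1)] unfolding Units_iff cgenideal_def by force
  then obtain M where "maximalideal M R" "PIdl x \<subseteq> M"
    using ideal_subset_maximalideal[OF cgenideal_ideal[OF assms(1)]] by blast
  then show thesis using that cgenideal_self[OF assms(1)] by blast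
qed

text \<open>A unit in \<open>M\<close> would put \<open>1\<close> into \<open>M\<close>, and every
  nonunit lies in some maximal ideal, of which there is only one.\<close>

lemma maximalideal_local_eq:
  assumes "local_ring R" "maximalideal M R"
  shows "M = carrier R - Units R"
proof
  show "M \<subseteq> carrier R - Units R"
    using assms(2) ideal_Units ideal.Icarr unfolding maximalideal_iff by fast
  show "carrier R - Units R \<subseteq> M"
    using assms nonunit_in_maximalideal unfolding local_ring_def by blast
qed

text \<open>If \<open>x\<close> and \<open>1 - x\<close> are nonunits of a local ring, both lie in
  the maximal ideal, and so does their sum \<open>1\<close>. The right-hand side mentions units
  only, so it can be transported along homomorphisms.\<close>

lemma local_ring_iff:
  "local_ring R \<longleftrightarrow> \<one> \<noteq> \<zero> \<and> (\<forall>x\<in>carrier R. x \<in> Units R \<or> \<one> \<ominus> x \<in> Units R)"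
proof
  assume loc: "local_ring R"
  then obtain M where M: "maximalideal M R" unfolding local_ring_def by blast
  interpret M: maximalideal M R by fact
  have one: "\<one> \<notin> M" using M unfolding maximalideal_iff by blast
  note eq = maximalideal_local_eq[OF loc M]
  have "x \<in> Units R \<or> \<one> \<ominus> x \<in> Units R" if x: "x \<in> carrier R" for x
  proof (rule ccontr)
    assume "\<not> ?thesis"
    then have "x \<in> M" "\<one> \<ominus> x \<in> M" unfolding eq using x by auto
    then have "(\<one> \<ominus> x) \<oplus> x \<in> M" by blast
    then show False using one x by (simp add: a_minus_def a_assoc l_neg)
  qed
  then show "\<one> \<noteq> \<zero> \<and> (\<forall>x\<in>carrier R. x \<in> Units R \<or> \<one> \<ominus> x \<in> Units R)"
    using one M.zero_closed by metis
next
  assume *: "\<one> \<noteq> \<zero> \<and> (\<forall>x\<in>carrier R. x \<in> Units R \<or> \<one> \<ominus> x \<in> Units R)"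
  have "\<one> \<notin> {\<zero>}" using * by simp
  then obtain M where M: "maximalideal M R"
    using ideal_subset_maximalideal[OF zeroideal] by blast
  \<comment> \<open>Uniqueness: the inclusion holds for every ordered pair of maximal ideals. An
    \<open>x\<close> in \<open>N\<close> outside \<open>K\<close> has a \<open>b\<close> with
    \<open>x b\<close> in \<open>N\<close> and \<open>1 - x b\<close> in \<open>K\<close>, yet one
    of these two is a unit.\<close>
  have "N \<subseteq> K" if N: "maximalideal N R" and K: "maximalideal K R" for N K
  proof
    fix x assume x: "x \<in> N"
    interpret N: maximalideal N R by fact
    show "x \<in> K"
    proof (rule ccontr)
      assume "x \<notin> K"
      then obtain b where b: "b \<in> carrier R" "\<one> \<ominus> x \<otimes> b \<in> K"
        using K x N.Icarr unfolding maximalideal_iff by blast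
      have xb: "x \<otimes> b \<in> N" using N.I_r_closed[OF x b(1)] .
      then have "x \<otimes> b \<in> Units R \<or> \<one> \<ominus> x \<otimes> b \<in> Units R" using * N.Icarr by blast
      then show False
        using ideal_Units[OF _ xb] ideal_Units[OF _ b(2)] N K unfolding maximalideal_iff by blast
    qed
  qed
  then show "local_ring R"
    unfolding local_ring_def using M is_cring by blast
qed

text \<open>The usual criterion asks for units \<open>1 + i b\<close> with \<open>b\<close>
  arbitrary; as \<open>I\<close> is an ideal, \<open>i b\<close> ranges over \<open>I\<close> again,
  so the elements \<open>1 + i\<close> suffice.\<close>

lemma ideal_subset_jacobson_radical_iff:
  assumes "ideal I R"
  shows "I \<subseteq> jacobson_radical R \<longleftrightarrow> (\<forall>i\<in>I. \<one> \<oplus> i \<in> Units R)"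
proof
  interpret I: ideal I R by fact
  assume sub: "I \<subseteq> jacobson_radical R"
  show "\<forall>i\<in>I. \<one> \<oplus> i \<in> Units R"
  proof (rule ccontr)
    assume "\<not> ?thesis"
    then obtain i where i: "i \<in> I" "\<one> \<oplus> i \<notin> Units R" by blast
    then have ic: "i \<in> carrier R" using I.Icarr by blast
    then obtain M where M: "maximalideal M R" "\<one> \<oplus> i \<in> M"
      using nonunit_in_maximalideal[of "\<one> \<oplus> i"] i(2) by auto
    interpret M: maximalideal M R by (rule M)
    have "i \<in> M" using sub i M unfolding jacobson_radical_def by blast
    then have "(\<one> \<oplus> i) \<oplus> \<ominus> i \<in> M" using M(2) by blast
    then show False using M(1) ic unfolding maximalideal_iff by (simp add: a_assoc r_neg)
  qed
next
  interpret I: ideal I R by fact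
  assume *: "\<forall>i\<in>I. \<one> \<oplus> i \<in> Units R"
  have "i \<in> M" if i: "i \<in> I" and M: "maximalideal M R" for i M
  proof (rule ccontr)
    assume "i \<notin> M"
    then obtain b where b: "b \<in> carrier R" "\<one> \<ominus> i \<otimes> b \<in> M"
      using M i I.Icarr unfolding maximalideal_iff by blast
    have "\<ominus> (i \<otimes> b) \<in> I" using I.I_r_closed[OF i b(1)] by blast
    then have "\<one> \<ominus> i \<otimes> b \<in> Units R" using * unfolding a_minus_def by blast
    then show False using M b(2) ideal_Units unfolding maximalideal_iff by blast
  qed
  then show "I \<subseteq> jacobson_radical R" unfolding jacobson_radical_def using I.Icarr by blast
qed

text \<open>From \<open>(1 + i) v = 1\<close> follows \<open>v = 1 - i v\<close>. Hence inverses of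
  elements of \<open>1 + I\<close> stay in \<open>1 + I\<close>, and so in every subring that
  contains \<open>1 + I\<close>.\<close>

lemma one_plus_ideal_inverse:
  assumes "ideal I R" "i \<in> I" "\<one> \<oplus> i \<in> Units R"
  obtains k where "k \<in> I" "(\<one> \<oplus> i) \<otimes> (\<one> \<oplus> k) = \<one>"
proof -
  interpret I: ideal I R by fact
  have i: "i \<in> carrier R" using assms(2) by (rule I.Icarr)
  obtain v where v: "v \<in> carrier R" "(\<one> \<oplus> i) \<otimes> v = \<one>" using assms(3) unfolding Units_iff by blast
  have "v = \<one> \<oplus> \<ominus> (i \<otimes> v)"
    using i v(1) by (subst v(2)[symmetric]) (simp add: l_distr a_assoc r_neg)
  moreover have "\<ominus> (i \<otimes> v) \<in> I" using I.I_r_closed[OF assms(2) v(1)] by blast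
  ultimately show thesis using that v(2) by metis
qed

text \<open>The element \<open>- i\<close> of a proper ideal is a nonunit, so
  \<open>1 - (- i)\<close> must be a unit.\<close>

lemma local_ring_one_plus_ideal:
  assumes "local_ring R" "ideal I R" "\<one> \<notin> I" "i \<in> I"
  shows "\<one> \<oplus> i \<in> Units R"
proof -
  interpret I: ideal I R by fact
  have i: "i \<in> carrier R" using assms(4) by (rule I.Icarr)
  have "\<one> \<ominus> \<ominus> i = \<one> \<oplus> i" using i by (simp add: a_minus_def)
  moreover have "\<ominus> i \<notin> Units R" using ideal_Units[OF assms(2)] assms(3,4) by blast
  ultimately show ?thesis using assms(1) i unfolding local_ring_iff by (metis a_inv_closed)
qed

end

section \<open>Locality along a surjection\<close>

lemma (in ring_hom_cring) local_ring_surj_iff: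
  assumes surj: "h ` carrier R = carrier S" and nontriv: "\<one>\<^bsub>S\<^esub> \<noteq> \<zero>\<^bsub>S\<^esub>"
  shows "local_ring R \<longleftrightarrow> local_ring S \<and> (\<forall>k\<in>a_kernel R S h. \<one> \<oplus> k \<in> Units R)"
proof safe
  assume loc: "local_ring R"
  have unit: "h x \<in> Units S" if x: "x \<in> Units R" for x
  proof -
    obtain y where xy: "x \<in> carrier R" "y \<in> carrier R" "x \<otimes> y = \<one>"
      using x unfolding R.Units_iff by blast
    then have "h x \<otimes>\<^bsub>S\<^esub> h y = \<one>\<^bsub>S\<^esub>" by (metis hom_mult hom_one)
    then show ?thesis unfolding S.Units_iff using xy by auto
  qed
  show "local_ring S"
    unfolding S.local_ring_iff
  proof (intro conjI ballI nontriv)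
    fix s assume "s \<in> carrier S"
    then obtain x where x: "x \<in> carrier R" "s = h x" using surj by blast
    have "h (\<one> \<ominus> x) = \<one>\<^bsub>S\<^esub> \<ominus>\<^bsub>S\<^esub> s" using x by (simp add: a_minus_def)
    then show "s \<in> Units S \<or> \<one>\<^bsub>S\<^esub> \<ominus>\<^bsub>S\<^esub> s \<in> Units S"
      using loc x unit unfolding R.local_ring_iff by metis
  qed
  fix k assume k: "k \<in> a_kernel R S h"
  have "\<one> \<notin> a_kernel R S h" using nontriv unfolding a_kernel_def' by simp
  then show "\<one> \<oplus> k \<in> Units R"
    using R.local_ring_one_plus_ideal[OF loc ring.kernel_is_ideal] k by blast
next
  assume loc: "local_ring S" and ker: "\<forall>k\<in>a_kernel R S h. \<one> \<oplus> k \<in> Units R"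
  \<comment> \<open>Units lift: if \<open>h y\<close> inverts \<open>h x\<close>, then
    \<open>x y - 1\<close> lies in the kernel, so \<open>x y = 1 + (x y - 1)\<close> is a unit and
    so is its factor \<open>x\<close>.\<close>
  have unit: "x \<in> Units R" if x: "x \<in> carrier R" and hx: "h x \<in> Units S" for x
  proof -
    obtain s where "s \<in> carrier S" "h x \<otimes>\<^bsub>S\<^esub> s = \<one>\<^bsub>S\<^esub>"
      using hx unfolding S.Units_iff by blast
    then obtain y where y: "y \<in> carrier R" "h x \<otimes>\<^bsub>S\<^esub> h y = \<one>\<^bsub>S\<^esub>"
      unfolding surj[symmetric] by blast
    have "x \<otimes> y \<ominus> \<one> \<in> a_kernel R S h"
      using x y unfolding a_kernel_def' by (simp add: a_minus_def S.r_neg)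
    then have "\<one> \<oplus> (x \<otimes> y \<ominus> \<one>) \<in> Units R" using ker by blast
    moreover have "\<one> \<oplus> (x \<otimes> y \<ominus> \<one>) = x \<otimes> y"
      using x y by (simp add: a_minus_def R.a_lcomm[of \<one>] R.r_neg)
    ultimately show ?thesis using R.unit_factor x y(1) by metis
  qed
  show "local_ring R"
    unfolding R.local_ring_iff
  proof (intro conjI ballI)
    show "\<one> \<noteq> \<zero>" using nontriv hom_one hom_zero by metis
    fix x assume x: "x \<in> carrier R"
    have "h (\<one> \<ominus> x) = \<one>\<^bsub>S\<^esub> \<ominus>\<^bsub>S\<^esub> h x" using x by (simp add: a_minus_def)
    then show "x \<in> Units R \<or> \<one> \<ominus> x \<in> Units R"
      using loc x unit unfolding S.local_ring_iff by (metis R.minus_closed R.one_closed hom_closed)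
  qed
qed

section \<open>Operations of the two rings under study\<close>

lemma image_plus_ideal_simps:
  "\<zero>\<^bsub>image_plus_ideal A B f J\<^esub> = \<zero>\<^bsub>B\<^esub>" "\<one>\<^bsub>image_plus_ideal A B f J\<^esub> = \<one>\<^bsub>B\<^esub>"
  "x \<oplus>\<^bsub>image_plus_ideal A B f J\<^esub> y = x \<oplus>\<^bsub>B\<^esub> y" "x \<otimes>\<^bsub>image_plus_ideal A B f J\<^esub> y = x \<otimes>\<^bsub>B\<^esub> y"
  "carrier (image_plus_ideal A B f J) = {f a \<oplus>\<^bsub>B\<^esub> j | a j. a \<in> carrier A \<and> j \<in> J}"
  by (auto simp: image_plus_ideal_def set_add_def')

lemma bi_amalg_simps:
  "\<zero>\<^bsub>bi_amalg A B C f g J J'\<^esub> = (\<zero>\<^bsub>B\<^esub>, \<zero>\<^bsub>C\<^esub>)"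
  "\<one>\<^bsub>bi_amalg A B C f g J J'\<^esub> = (\<one>\<^bsub>B\<^esub>, \<one>\<^bsub>C\<^esub>)"
  "x \<oplus>\<^bsub>bi_amalg A B C f g J J'\<^esub> y = (fst x \<oplus>\<^bsub>B\<^esub> fst y, snd x \<oplus>\<^bsub>C\<^esub> snd y)"
  "x \<otimes>\<^bsub>bi_amalg A B C f g J J'\<^esub> y = (fst x \<otimes>\<^bsub>B\<^esub> fst y, snd x \<otimes>\<^bsub>C\<^esub> snd y)"
  "carrier (bi_amalg A B C f g J J') = bi_amalg_set B C f g J J' (carrier A)"
  by (cases x; cases y; simp add: bi_amalg_def RDirProd_simps flip: RDirProd_simps(2,3);
      simp add: RDirProd_simps)+

section \<open>The subring \<open>f(A) + J\<close>\<close>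

locale hom_to_ideal = ring_hom_cring A B f for A (structure) and B (structure) and f +
  fixes J
  assumes J: "ideal J B"
begin

sublocale J: ideal J B by (rule J)

abbreviation P where "P \<equiv> image_plus_ideal A B f J"

sublocale P: cring P
  using image_plus_ideal_cring(2)[OF _ _ homh J] R.is_cring S.is_cring by blast

lemma ideal_image_plus_ideal: "ideal J P"
proof (rule idealI[OF P.ring_axioms])
  have JP: "J \<subseteq> carrier P"
  proof
    fix j assume "j \<in> J"
    then have "j = f \<zero> \<oplus>\<^bsub>B\<^esub> j" using J.Icarr by simp
    then show "j \<in> carrier P" unfolding image_plus_ideal_simps using \<open>j \<in> J\<close> by blast
  qed
  \<comment> \<open>Negation is defined by a description relative to the carrier, so negation in the
    subring has to be matched with negation in \<open>B\<close>.\<close>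
  have inv: "\<ominus>\<^bsub>P\<^esub> j = \<ominus>\<^bsub>B\<^esub> j" if "j \<in> J" for j
    using that JP J.Icarr J.a_inv_closed
    by (intro P.minus_equality) (auto simp: image_plus_ideal_simps(1-4) S.l_neg)
  show "subgroup J (add_monoid P)"
  proof
    show "J \<subseteq> carrier (add_monoid P)" using JP by simp
    show "inv\<^bsub>add_monoid P\<^esub> j \<in> J" if "j \<in> J" for j
      using inv[OF that] that J.a_inv_closed unfolding a_inv_def by simp
  qed (auto simp: image_plus_ideal_simps J.a_closed J.zero_closed)
  fix j x assume "j \<in> J" "x \<in> carrier P"
  moreover from this have "x \<in> carrier B"
    unfolding image_plus_ideal_simps using J.Icarr by auto
  ultimately show "x \<otimes>\<^bsub>P\<^esub> j \<in> J" "j \<otimes>\<^bsub>P\<^esub> x \<in> J"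
    by (auto simp: image_plus_ideal_simps J.I_l_closed J.I_r_closed)
qed

text \<open>The inverse of \<open>1 + j\<close> in \<open>B\<close> has the form
  \<open>1 + k\<close> with \<open>k\<close> in \<open>J\<close>, hence already lies in
  \<open>f(A) + J\<close>.\<close>

lemma one_plus_Units_image_plus_ideal:
  assumes "j \<in> J"
  shows "\<one>\<^bsub>B\<^esub> \<oplus>\<^bsub>B\<^esub> j \<in> Units P \<longleftrightarrow> \<one>\<^bsub>B\<^esub> \<oplus>\<^bsub>B\<^esub> j \<in> Units B"
proof
  have PB: "carrier P \<subseteq> carrier B" unfolding image_plus_ideal_simps using J.Icarr by auto
  have in_P: "\<one>\<^bsub>B\<^esub> \<oplus>\<^bsub>B\<^esub> k \<in> carrier P" if "k \<in> J" for k
    using that hom_one R.one_closed unfolding image_plus_ideal_simps by force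
  show "\<one>\<^bsub>B\<^esub> \<oplus>\<^bsub>B\<^esub> j \<in> Units B" if "\<one>\<^bsub>B\<^esub> \<oplus>\<^bsub>B\<^esub> j \<in> Units P"
    using that PB unfolding P.Units_iff S.Units_iff image_plus_ideal_simps(2,4) by blast
  assume "\<one>\<^bsub>B\<^esub> \<oplus>\<^bsub>B\<^esub> j \<in> Units B"
  then obtain k where "k \<in> J" "(\<one>\<^bsub>B\<^esub> \<oplus>\<^bsub>B\<^esub> j) \<otimes>\<^bsub>B\<^esub> (\<one>\<^bsub>B\<^esub> \<oplus>\<^bsub>B\<^esub> k) = \<one>\<^bsub>B\<^esub>"
    using S.one_plus_ideal_inverse[OF J assms] by blast
  then show "\<one>\<^bsub>B\<^esub> \<oplus>\<^bsub>B\<^esub> j \<in> Units P"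
    unfolding P.Units_iff image_plus_ideal_simps(2,4) using in_P assms by blast
qed

lemma local_image_plus_ideal_one_plus:
  assumes "local_ring P" "\<one>\<^bsub>B\<^esub> \<notin> J" "j \<in> J"
  shows "\<one>\<^bsub>B\<^esub> \<oplus>\<^bsub>B\<^esub> j \<in> Units B"
  using P.local_ring_one_plus_ideal[OF assms(1) ideal_image_plus_ideal _ assms(3)] assms(2,3)
  by (simp add: image_plus_ideal_simps one_plus_Units_image_plus_ideal)

text \<open>The dichotomy of \<open>A\<close> for \<open>a\<close> and \<open>1 - a\<close> carries
  over to \<open>x = f a + j\<close> and \<open>1 - x = f (1 - a) - j\<close>, because
  \<open>f a + j\<close> is a unit whenever \<open>a\<close> is.\<close>

lemma local_image_plus_ideal:
  assumes "local_ring A" "\<one>\<^bsub>B\<^esub> \<noteq> \<zero>\<^bsub>B\<^esub>" and unit: "\<And>j. j \<in> J \<Longrightarrow> \<one>\<^bsub>B\<^esub> \<oplus>\<^bsub>B\<^esub> j \<in> Units B"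
  shows "local_ring P"
  unfolding P.local_ring_iff
proof (intro conjI ballI)
  show "\<one>\<^bsub>P\<^esub> \<noteq> \<zero>\<^bsub>P\<^esub>" using assms(2) by (simp add: image_plus_ideal_simps)
  have in_P: "f a \<oplus>\<^bsub>B\<^esub> j \<in> carrier P" if "a \<in> carrier A" "j \<in> J" for a j
    using that unfolding image_plus_ideal_simps by blast
  have U: "f a \<oplus>\<^bsub>B\<^esub> j \<in> Units P" if a: "a \<in> Units A" and j: "j \<in> J" for a j
  proof -
    obtain b where b: "a \<in> carrier A" "b \<in> carrier A" "a \<otimes> b = \<one>"
      using a unfolding R.Units_iff by blast
    have fb: "f b \<in> carrier P" using in_P[OF b(2) J.zero_closed] b(2) by simp
    \<comment> \<open>Multiplying by the image of the inverse of \<open>a\<close> moves the element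
      into \<open>1 + J\<close>, which consists of units.\<close>
    have "(f a \<oplus>\<^bsub>B\<^esub> j) \<otimes>\<^bsub>B\<^esub> f b = \<one>\<^bsub>B\<^esub> \<oplus>\<^bsub>B\<^esub> j \<otimes>\<^bsub>B\<^esub> f b"
      using b j J.Icarr by (simp add: S.l_distr flip: hom_mult)
    also have "\<dots> \<in> Units P"
      using J.I_r_closed[OF j] b(2) by (simp add: one_plus_Units_image_plus_ideal unit)
    finally have "(f a \<oplus>\<^bsub>B\<^esub> j) \<otimes>\<^bsub>P\<^esub> f b \<in> Units P" by (simp add: image_plus_ideal_simps)
    then show ?thesis using P.unit_factor in_P[OF b(1) j] fb by blast
  qed
  fix x assume x: "x \<in> carrier P"
  then obtain a j where a: "a \<in> carrier A" "j \<in> J" "x = f a \<oplus>\<^bsub>B\<^esub> j"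
    unfolding image_plus_ideal_simps by blast
  have j: "j \<in> carrier B" using a(2) by (rule J.Icarr)
  have y: "f (\<one> \<ominus> a) \<oplus>\<^bsub>B\<^esub> \<ominus>\<^bsub>B\<^esub> j \<in> carrier P"
    using a by (intro in_P) auto
  \<comment> \<open>The candidate for \<open>1 - x\<close> is verified by adding \<open>x\<close>,
    so negation in the subring need not be computed.\<close>
  have "(f (\<one> \<ominus> a) \<oplus>\<^bsub>B\<^esub> \<ominus>\<^bsub>B\<^esub> j) \<oplus>\<^bsub>B\<^esub> x = \<one>\<^bsub>B\<^esub>"
  proof -
    have "(f (\<one> \<ominus> a) \<oplus>\<^bsub>B\<^esub> \<ominus>\<^bsub>B\<^esub> j) \<oplus>\<^bsub>B\<^esub> (f a \<oplus>\<^bsub>B\<^esub> j) =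
        (f (\<one> \<ominus> a) \<oplus>\<^bsub>B\<^esub> f a) \<oplus>\<^bsub>B\<^esub> (\<ominus>\<^bsub>B\<^esub> j \<oplus>\<^bsub>B\<^esub> j)"
      using a(1) j by (simp add: S.a_ac)
    also have "\<dots> = f ((\<one> \<ominus> a) \<oplus> a) \<oplus>\<^bsub>B\<^esub> \<zero>\<^bsub>B\<^esub>" using a(1) j by (simp add: S.l_neg)
    also have "\<dots> = \<one>\<^bsub>B\<^esub>" using a(1) by (simp add: a_minus_def R.a_assoc R.l_neg del: hom_add)
    finally show ?thesis unfolding a(3) .
  qed
  then have "\<one>\<^bsub>P\<^esub> = (f (\<one> \<ominus> a) \<oplus>\<^bsub>B\<^esub> \<ominus>\<^bsub>B\<^esub> j) \<oplus>\<^bsub>P\<^esub> x" by (simp add: image_plus_ideal_simps)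
  then have "\<one>\<^bsub>P\<^esub> \<ominus>\<^bsub>P\<^esub> x = f (\<one> \<ominus> a) \<oplus>\<^bsub>B\<^esub> \<ominus>\<^bsub>B\<^esub> j"
    using x y by (simp add: a_minus_def P.a_assoc P.r_neg)
  moreover have "a \<in> Units A \<or> \<one> \<ominus> a \<in> Units A"
    using assms(1) a(1) unfolding R.local_ring_iff by blast
  ultimately show "x \<in> Units P \<or> \<one>\<^bsub>P\<^esub> \<ominus>\<^bsub>P\<^esub> x \<in> Units P"
    using U a(2,3) by auto
qed

end

section \<open>The bi-amalgamation, its projections and its locality\<close>

locale bi_amalgamation = F: hom_to_ideal A B f J + G: hom_to_ideal A C g J'
  for A (structure) and B (structure) and C (structure) and f and g and J and J' +
  assumes same_preimage: "a \<in> carrier A \<Longrightarrow> f a \<in> J \<longleftrightarrow> g a \<in> J'"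
    and one_not_zero: "\<one>\<^bsub>B\<^esub> \<noteq> \<zero>\<^bsub>B\<^esub>" "\<one>\<^bsub>C\<^esub> \<noteq> \<zero>\<^bsub>C\<^esub>"
begin

abbreviation D where "D \<equiv> bi_amalg A B C f g J J'"

sublocale D: cring D
  using F.R.is_cring F.S.is_cring G.S.is_cring F.homh G.homh F.J G.J by (intro bi_amalg_cring)

lemma carrier_D:
  "x \<in> carrier D \<longleftrightarrow> (\<exists>a\<in>carrier A. \<exists>j\<in>J. \<exists>j'\<in>J'. x = (f a \<oplus>\<^bsub>B\<^esub> j, g a \<oplus>\<^bsub>C\<^esub> j'))"
  unfolding bi_amalg_simps bi_amalg_set_def by blast

text \<open>The map along which the maximal ideal of \<open>D\<close> is later pulled back to
  \<open>A\<close>.\<close>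

lemma diagonal_hom: "ring_hom_cring A D (\<lambda>a. (f a, g a))"
proof (intro ring_hom_cring.intro ring_hom_cring_axioms.intro F.R.is_cring D.is_cring ring_hom_memI)
  fix a assume a: "a \<in> carrier A"
  then have "(f a, g a) = (f a \<oplus>\<^bsub>B\<^esub> \<zero>\<^bsub>B\<^esub>, g a \<oplus>\<^bsub>C\<^esub> \<zero>\<^bsub>C\<^esub>)" by simp
  then show "(f a, g a) \<in> carrier D"
    unfolding carrier_D using a F.J.zero_closed G.J.zero_closed by blast
qed (simp_all add: bi_amalg_simps)

sublocale diagonal: ring_hom_cring A D "\<lambda>a. (f a, g a)" by (rule diagonal_hom)

lemma proj_homs: "ring_hom_cring D F.P fst" "ring_hom_cring D G.P snd"
  and proj_images: "fst ` carrier D = carrier F.P" "snd ` carrier D = carrier G.P"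
proof -
  have in_D: "(f a \<oplus>\<^bsub>B\<^esub> j, g a \<oplus>\<^bsub>C\<^esub> j') \<in> carrier D"
    if "a \<in> carrier A" "j \<in> J" "j' \<in> J'" for a j j'
    unfolding carrier_D using that by blast
  show im_fst: "fst ` carrier D = carrier F.P"
  proof
    show "fst ` carrier D \<subseteq> carrier F.P"
      unfolding image_plus_ideal_simps image_subset_iff Ball_def carrier_D
      by (intro allI impI, elim bexE, hypsubst, unfold fst_conv snd_conv) blast
    show "carrier F.P \<subseteq> fst ` carrier D"
    proof
      fix x assume "x \<in> carrier F.P"
      then obtain a j where x: "a \<in> carrier A" "j \<in> J" "x = f a \<oplus>\<^bsub>B\<^esub> j"
        unfolding image_plus_ideal_simps by blast
      show "x \<in> fst ` carrier D"
        by (rule image_eqI[OF _ in_D[OF x(1,2) G.J.zero_closed]]) (simp add: x(3))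
    qed
  qed
  show im_snd: "snd ` carrier D = carrier G.P"
  proof
    show "snd ` carrier D \<subseteq> carrier G.P"
      unfolding image_plus_ideal_simps image_subset_iff Ball_def carrier_D
      by (intro allI impI, elim bexE, hypsubst, unfold fst_conv snd_conv) blast
    show "carrier G.P \<subseteq> snd ` carrier D"
    proof
      fix x assume "x \<in> carrier G.P"
      then obtain a j where x: "a \<in> carrier A" "j \<in> J'" "x = g a \<oplus>\<^bsub>C\<^esub> j"
        unfolding image_plus_ideal_simps by blast
      show "x \<in> snd ` carrier D"
        by (rule image_eqI[OF _ in_D[OF x(1) F.J.zero_closed x(2)]]) (simp add: x(3))
    qed
  qed
  have "fst \<in> ring_hom D F.P" "snd \<in> ring_hom D G.P"
    using im_fst im_snd
    by (auto intro!: ring_hom_memI simp: image_plus_ideal_simps(1-4) bi_amalg_simps(1-4))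
  then show "ring_hom_cring D F.P fst" "ring_hom_cring D G.P snd"
    by (auto intro!: ring_hom_cring.intro ring_hom_cring_axioms.intro
        D.is_cring F.P.is_cring G.P.is_cring)
qed

text \<open>The equality of preimages at \<open>a = 1\<close>: properness of either ideal gives
  properness of the other.\<close>

lemma one_mem_ideals_iff: "\<one>\<^bsub>B\<^esub> \<in> J \<longleftrightarrow> \<one>\<^bsub>C\<^esub> \<in> J'"
  using same_preimage[of \<one>] by simp

text \<open>The inverse of \<open>1 + j'\<close> in \<open>C\<close> is some \<open>1 + k\<close>
  with \<open>k\<close> in \<open>J'\<close>, and \<open>(1, 1 + k)\<close> belongs to
  \<open>D\<close>.\<close>

lemma one_plus_Units_D:
  assumes "j' \<in> J'"
  shows "(\<one>\<^bsub>B\<^esub>, \<one>\<^bsub>C\<^esub> \<oplus>\<^bsub>C\<^esub> j') \<in> Units D \<longleftrightarrow> \<one>\<^bsub>C\<^esub> \<oplus>\<^bsub>C\<^esub> j' \<in> Units C"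
proof
  have in_D: "(\<one>\<^bsub>B\<^esub>, \<one>\<^bsub>C\<^esub> \<oplus>\<^bsub>C\<^esub> k) \<in> carrier D" if "k \<in> J'" for k
  proof -
    have "(\<one>\<^bsub>B\<^esub>, \<one>\<^bsub>C\<^esub> \<oplus>\<^bsub>C\<^esub> k) = (f \<one> \<oplus>\<^bsub>B\<^esub> \<zero>\<^bsub>B\<^esub>, g \<one> \<oplus>\<^bsub>C\<^esub> k)" by simp
    then show ?thesis unfolding carrier_D using that F.J.zero_closed by blast
  qed
  show "\<one>\<^bsub>C\<^esub> \<oplus>\<^bsub>C\<^esub> j' \<in> Units C" if unit: "(\<one>\<^bsub>B\<^esub>, \<one>\<^bsub>C\<^esub> \<oplus>\<^bsub>C\<^esub> j') \<in> Units D"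
  proof -
    obtain y where y: "y \<in> carrier D" "(\<one>\<^bsub>C\<^esub> \<oplus>\<^bsub>C\<^esub> j') \<otimes>\<^bsub>C\<^esub> snd y = \<one>\<^bsub>C\<^esub>"
      using unit unfolding D.Units_iff bi_amalg_simps by auto
    then have "snd y \<in> carrier C" using G.J.Icarr unfolding carrier_D by auto
    then show ?thesis unfolding G.S.Units_iff using y(2) assms G.J.Icarr by auto
  qed
  assume "\<one>\<^bsub>C\<^esub> \<oplus>\<^bsub>C\<^esub> j' \<in> Units C"
  then obtain k where k: "k \<in> J'" "(\<one>\<^bsub>C\<^esub> \<oplus>\<^bsub>C\<^esub> j') \<otimes>\<^bsub>C\<^esub> (\<one>\<^bsub>C\<^esub> \<oplus>\<^bsub>C\<^esub> k) = \<one>\<^bsub>C\<^esub>"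
    using G.S.one_plus_ideal_inverse[OF G.J assms] by blast
  then have "(\<one>\<^bsub>B\<^esub>, \<one>\<^bsub>C\<^esub> \<oplus>\<^bsub>C\<^esub> j') \<otimes>\<^bsub>D\<^esub> (\<one>\<^bsub>B\<^esub>, \<one>\<^bsub>C\<^esub> \<oplus>\<^bsub>C\<^esub> k) = \<one>\<^bsub>D\<^esub>"
    by (simp add: bi_amalg_simps)
  then show "(\<one>\<^bsub>B\<^esub>, \<one>\<^bsub>C\<^esub> \<oplus>\<^bsub>C\<^esub> j') \<in> Units D"
    unfolding D.Units_iff using in_D assms k(1) by blast
qed

lemma kernel_fst: "a_kernel D F.P fst = {\<zero>\<^bsub>B\<^esub>} \<times> J'"
proof (intro equalityI subsetI)
  fix x assume "x \<in> a_kernel D F.P fst"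
  then obtain a j j' where x: "a \<in> carrier A" "j \<in> J" "j' \<in> J'"
      "x = (\<zero>\<^bsub>B\<^esub>, g a \<oplus>\<^bsub>C\<^esub> j')" "f a \<oplus>\<^bsub>B\<^esub> j = \<zero>\<^bsub>B\<^esub>"
    unfolding a_kernel_def' mem_Collect_eq carrier_D image_plus_ideal_simps by force
  \<comment> \<open>Here the common preimage enters: \<open>f a + j = 0\<close> forces
    \<open>f a\<close> into \<open>J\<close>, hence \<open>g a\<close> into \<open>J'\<close>, and
    the second entry \<open>g a + j'\<close> stays in \<open>J'\<close>.\<close>
  have "f a = \<ominus>\<^bsub>B\<^esub> j" using x F.J.Icarr by (metis F.S.minus_equality F.S.minus_minus F.hom_closed)
  then have "f a \<in> J" using x(2) F.J.a_inv_closed by simp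
  then have "g a \<in> J'" using same_preimage x(1) by blast
  then show "x \<in> {\<zero>\<^bsub>B\<^esub>} \<times> J'" using x(3,4) G.J.a_closed by simp
next
  fix x assume "x \<in> {\<zero>\<^bsub>B\<^esub>} \<times> J'"
  then obtain j' where x: "x = (\<zero>\<^bsub>B\<^esub>, j')" "j' \<in> J'" by blast
  then have "x = (f \<zero> \<oplus>\<^bsub>B\<^esub> \<zero>\<^bsub>B\<^esub>, g \<zero> \<oplus>\<^bsub>C\<^esub> j')" using G.J.Icarr by simp
  then have "x \<in> carrier D" unfolding carrier_D using x(2) F.J.zero_closed by blast
  then show "x \<in> a_kernel D F.P fst"
    unfolding a_kernel_def' using x by (simp add: image_plus_ideal_simps)
qed

text \<open>The surjection criterion for the first projection, whose kernel is
  \<open>0 \<times> J'\<close>.\<close>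

lemma local_D_iff_one_plus:
  "local_ring D \<longleftrightarrow> local_ring F.P \<and> (\<forall>j'\<in>J'. \<one>\<^bsub>C\<^esub> \<oplus>\<^bsub>C\<^esub> j' \<in> Units C)"
proof -
  have "\<one>\<^bsub>F.P\<^esub> \<noteq> \<zero>\<^bsub>F.P\<^esub>" using one_not_zero by (simp add: image_plus_ideal_simps)
  from ring_hom_cring.local_ring_surj_iff[OF proj_homs(1) proj_images(1) this]
  show ?thesis unfolding kernel_fst by (simp add: bi_amalg_simps one_plus_Units_D)
qed

lemma local_D_imp_proper:
  assumes "local_ring D"
  shows "\<one>\<^bsub>B\<^esub> \<notin> J"
proof
  assume "\<one>\<^bsub>B\<^esub> \<in> J"
  \<comment> \<open>With \<open>-1\<close> in \<open>J'\<close>, the unit condition on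
    \<open>1 + J'\<close> would make \<open>0\<close> a unit of \<open>C\<close>.\<close>
  then have "\<ominus>\<^bsub>C\<^esub> \<one>\<^bsub>C\<^esub> \<in> J'" using one_mem_ideals_iff G.J.a_inv_closed by blast
  then have "\<one>\<^bsub>C\<^esub> \<oplus>\<^bsub>C\<^esub> \<ominus>\<^bsub>C\<^esub> \<one>\<^bsub>C\<^esub> \<in> Units C" using assms unfolding local_D_iff_one_plus by blast
  then show False using one_not_zero(2) by (simp add: G.S.r_neg G.S.Units_iff)
qed

text \<open>Locality of \<open>g(A) + J'\<close> descends from \<open>D\<close> along the second
  projection. Conversely, it makes \<open>1 + J'\<close> consist of units, since \<open>J'\<close>
  is proper along with \<open>J\<close>.\<close>

lemma local_D_iff: "local_ring D \<longleftrightarrow> J \<noteq> carrier B \<and> local_ring F.P \<and> local_ring G.P"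
proof (intro iffI conjI)
  assume loc: "local_ring D"
  show "local_ring F.P" using loc unfolding local_D_iff_one_plus by blast
  have "\<one>\<^bsub>G.P\<^esub> \<noteq> \<zero>\<^bsub>G.P\<^esub>" using one_not_zero by (simp add: image_plus_ideal_simps)
  from ring_hom_cring.local_ring_surj_iff[OF proj_homs(2) proj_images(2) this]
  show "local_ring G.P" using loc by blast
  show "J \<noteq> carrier B" using local_D_imp_proper[OF loc] by auto
next
  assume "J \<noteq> carrier B \<and> local_ring F.P \<and> local_ring G.P"
  then show "local_ring D"
    unfolding local_D_iff_one_plus
    using G.local_image_plus_ideal_one_plus one_mem_ideals_iff F.J.one_imp_carrier by blast
qed

section \<open>The maximal ideal of the bi-amalgamation\<close>

lemma Units_D_imp_inverse_mod:
  assumes "a \<in> carrier A" "j \<in> J" "j' \<in> J'" "(f a \<oplus>\<^bsub>B\<^esub> j, g a \<oplus>\<^bsub>C\<^esub> j') \<in> Units D"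
  obtains b where "b \<in> carrier A" "f (\<one> \<ominus> a \<otimes> b) \<in> J"
proof -
  obtain b k where b: "b \<in> carrier A" "k \<in> J" "(f a \<oplus>\<^bsub>B\<^esub> j) \<otimes>\<^bsub>B\<^esub> (f b \<oplus>\<^bsub>B\<^esub> k) = \<one>\<^bsub>B\<^esub>"
    using assms(4) unfolding D.Units_iff Bex_def carrier_D by (auto simp: bi_amalg_simps)
  \<comment> \<open>Expanding the product in the first entry gives \<open>f (a b) + l = 1\<close>,
    so \<open>f (1 - a b) = l\<close> lies in \<open>J\<close>: \<open>b\<close> inverts
    \<open>a\<close> modulo the preimage of \<open>J\<close>.\<close>
  obtain l where l: "l \<in> J" "f (a \<otimes> b) \<oplus>\<^bsub>B\<^esub> l = \<one>\<^bsub>B\<^esub>"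
    using hom_plus_ideal_ops(2)[OF F.R.is_cring F.S.is_cring F.homh F.J assms(1) b(1) assms(2) b(2)]
    unfolding b(3) by metis
  have lc: "l \<in> carrier B" "f (a \<otimes> b) \<in> carrier B" using l(1) F.J.Icarr assms(1) b(1) by auto
  have "f (\<one> \<ominus> a \<otimes> b) = \<one>\<^bsub>B\<^esub> \<oplus>\<^bsub>B\<^esub> \<ominus>\<^bsub>B\<^esub> f (a \<otimes> b)"
    using assms(1) b(1) by (simp add: a_minus_def del: F.hom_mult)
  also have "\<dots> = l" unfolding l(2)[symmetric] using lc
    by (simp add: F.S.a_comm[of "f (a \<otimes> b)"] F.S.a_assoc F.S.r_neg del: F.hom_mult)
  finally show thesis using that b(1) l(1) by simp
qed

text \<open>If \<open>a\<close> lies in \<open>\<mm>\<close>, it cannot be invertible modulo an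
  ideal inside \<open>\<mm>\<close>. If not, choose \<open>b\<close> with \<open>1 - a b\<close> in
  \<open>\<mm>\<close>; then \<open>1 - x y\<close> with \<open>y = (f b, g b)\<close> is a nonunit
  by the first half, so locality makes \<open>x y\<close>, and hence \<open>x\<close>, a
  unit.\<close>

lemma Units_D_iff:
  assumes loc: "local_ring D" and m: "maximalideal \<mm> A" "{a \<in> carrier A. f a \<in> J} \<subseteq> \<mm>"
    and a: "a \<in> carrier A" and j: "j \<in> J" "j' \<in> J'"
  shows "(f a \<oplus>\<^bsub>B\<^esub> j, g a \<oplus>\<^bsub>C\<^esub> j') \<in> Units D \<longleftrightarrow> a \<notin> \<mm>"
proof
  interpret m: maximalideal \<mm> A by (rule m)
  have one: "\<one> \<notin> \<mm>" using m(1) unfolding F.R.maximalideal_iff by blast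
  \<comment> \<open>Stated for arbitrary \<open>c\<close>, \<open>k\<close>, \<open>k'\<close>
    because it is needed for \<open>a\<close> itself and again for \<open>1 - a b\<close>.\<close>
  have nonunit: "c \<notin> \<mm>"
    if c: "c \<in> carrier A" "k \<in> J" "k' \<in> J'" "(f c \<oplus>\<^bsub>B\<^esub> k, g c \<oplus>\<^bsub>C\<^esub> k') \<in> Units D" for c k k'
  proof
    assume "c \<in> \<mm>"
    obtain b where b: "b \<in> carrier A" "f (\<one> \<ominus> c \<otimes> b) \<in> J"
      using Units_D_imp_inverse_mod[OF c] by blast
    then have "\<one> \<ominus> c \<otimes> b \<in> \<mm>" using m(2) c(1) by auto
    moreover have "c \<otimes> b \<in> \<mm>" using m.I_r_closed[OF \<open>c \<in> \<mm>\<close> b(1)] .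
    ultimately have "(\<one> \<ominus> c \<otimes> b) \<oplus> c \<otimes> b \<in> \<mm>" by blast
    then show False using one b(1) c(1) by (simp add: a_minus_def F.R.a_assoc F.R.l_neg)
  qed
  then show "a \<notin> \<mm>" if "(f a \<oplus>\<^bsub>B\<^esub> j, g a \<oplus>\<^bsub>C\<^esub> j') \<in> Units D" using a j that by blast
  assume "a \<notin> \<mm>"
  then obtain b where b: "b \<in> carrier A" "\<one> \<ominus> a \<otimes> b \<in> \<mm>"
    using m(1) a unfolding F.R.maximalideal_iff by blast
  let ?x = "(f a \<oplus>\<^bsub>B\<^esub> j, g a \<oplus>\<^bsub>C\<^esub> j')" and ?y = "(f b, g b)"
  let ?z = "\<one>\<^bsub>D\<^esub> \<ominus>\<^bsub>D\<^esub> ?x \<otimes>\<^bsub>D\<^esub> ?y"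
  have D: "?x \<in> carrier D" "?y \<in> carrier D"
    unfolding carrier_D[of ?x] using a j diagonal.hom_closed[OF b(1)] by blast+
  have jc: "j \<in> carrier B" "j' \<in> carrier C" using j F.J.Icarr G.J.Icarr by auto
  have lB: "\<ominus>\<^bsub>B\<^esub> (j \<otimes>\<^bsub>B\<^esub> f b) \<in> J" using F.J.I_r_closed[OF j(1)] F.J.a_inv_closed b(1) by auto
  have lC: "\<ominus>\<^bsub>C\<^esub> (j' \<otimes>\<^bsub>C\<^esub> g b) \<in> J'" using G.J.I_r_closed[OF j(2)] G.J.a_inv_closed b(1) by auto
  \<comment> \<open>This is \<open>?z\<close> in the standard form of an element of
    \<open>D\<close>, represented by \<open>1 - a b\<close> with corrections \<open>- j f(b)\<close>
    and \<open>- j' g(b)\<close>.\<close>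
  let ?w = "(f (\<one> \<ominus> a \<otimes> b) \<oplus>\<^bsub>B\<^esub> \<ominus>\<^bsub>B\<^esub> (j \<otimes>\<^bsub>B\<^esub> f b), g (\<one> \<ominus> a \<otimes> b) \<oplus>\<^bsub>C\<^esub> \<ominus>\<^bsub>C\<^esub> (j' \<otimes>\<^bsub>C\<^esub> g b))"
  have w: "?w \<in> carrier D" unfolding carrier_D using a b lB lC by blast
  have wB: "f (\<one> \<ominus> a \<otimes> b) \<oplus>\<^bsub>B\<^esub> \<ominus>\<^bsub>B\<^esub> (j \<otimes>\<^bsub>B\<^esub> f b) \<oplus>\<^bsub>B\<^esub> (f a \<oplus>\<^bsub>B\<^esub> j) \<otimes>\<^bsub>B\<^esub> f b = \<one>\<^bsub>B\<^esub>"
    using a b(1) jc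
    by (simp add: a_minus_def F.S.l_distr F.S.a_ac F.S.r_neg F.S.r_neg1 F.S.r_neg2)
  have wC: "g (\<one> \<ominus> a \<otimes> b) \<oplus>\<^bsub>C\<^esub> \<ominus>\<^bsub>C\<^esub> (j' \<otimes>\<^bsub>C\<^esub> g b) \<oplus>\<^bsub>C\<^esub> (g a \<oplus>\<^bsub>C\<^esub> j') \<otimes>\<^bsub>C\<^esub> g b = \<one>\<^bsub>C\<^esub>"
    using a b(1) jc
    by (simp add: a_minus_def G.S.l_distr G.S.a_ac G.S.r_neg G.S.r_neg1 G.S.r_neg2)
  have "\<one>\<^bsub>D\<^esub> = ?w \<oplus>\<^bsub>D\<^esub> ?x \<otimes>\<^bsub>D\<^esub> ?y" unfolding bi_amalg_simps fst_conv snd_conv wB wC ..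
  then have "?z = ?w" using w D by (simp add: a_minus_def D.a_assoc D.r_neg)
  moreover have "?w \<notin> Units D" using nonunit[OF _ lB lC, of "\<one> \<ominus> a \<otimes> b"] a b by auto
  ultimately have "?x \<otimes>\<^bsub>D\<^esub> ?y \<in> Units D"
    using loc D unfolding D.local_ring_iff by (metis D.m_closed)
  then show "?x \<in> Units D" using D.unit_factor D by blast
qed

text \<open>\<open>M\<close> consists of the nonunits, and by \<open>Units_D_iff\<close> these are
  the elements represented by some \<open>a\<close> in \<open>\<mm>\<close>, whichever
  representation is chosen.\<close>

lemma maximalideal_D_eq:
  assumes loc: "local_ring D" and m: "maximalideal \<mm> A" "{a \<in> carrier A. f a \<in> J} \<subseteq> \<mm>"
    and M: "maximalideal M D"
  shows "M = bi_amalg_set B C f g J J' \<mm>"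
proof -
  have "\<mm> \<subseteq> carrier A" using m(1) ideal.Icarr unfolding F.R.maximalideal_iff by fast
  then have "x \<in> bi_amalg_set B C f g J J' \<mm> \<longleftrightarrow>
      (\<exists>a\<in>carrier A. \<exists>j\<in>J. \<exists>j'\<in>J'. x = (f a \<oplus>\<^bsub>B\<^esub> j, g a \<oplus>\<^bsub>C\<^esub> j') \<and> a \<in> \<mm>)" for x
    unfolding bi_amalg_set_def Bex_def by auto
  then show ?thesis
    unfolding D.maximalideal_local_eq[OF loc M] set_eq_iff Diff_iff carrier_D
    using Units_D_iff[OF loc m] by metis
qed

text \<open>Existence comes from pulling back the maximal ideal of \<open>D\<close> along the
  diagonal map. Uniqueness holds because \<open>Units_D_iff\<close> forces any such
  \<open>\<mm>\<close> to be the set of \<open>a\<close> with \<open>(f a, g a)\<close> a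
  nonunit.\<close>

lemma maximalideal_over_preimage:
  assumes loc: "local_ring D"
  shows "\<exists>!\<mm>. maximalideal \<mm> A \<and> {a \<in> carrier A. f a \<in> J} \<subseteq> \<mm>"
proof -
  obtain M where M: "maximalideal M D" using loc unfolding local_ring_def by blast
  note M_eq = D.maximalideal_local_eq[OF loc M]
  let ?m = "{a \<in> carrier A. (f a, g a) \<in> M}"
  \<comment> \<open>If such an \<open>a\<close> gave a unit, some \<open>1 - a b\<close> would map
    into \<open>J\<close>; \<open>a b\<close> does as well, so \<open>1\<close> would lie in
    \<open>J\<close>.\<close>
  have nonunit: "(f a, g a) \<notin> Units D" if a: "a \<in> carrier A" "f a \<in> J" for a
  proof
    assume "(f a, g a) \<in> Units D"
    then have "(f a \<oplus>\<^bsub>B\<^esub> \<zero>\<^bsub>B\<^esub>, g a \<oplus>\<^bsub>C\<^esub> \<zero>\<^bsub>C\<^esub>) \<in> Units D" using a(1) by simp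
    then obtain b where b: "b \<in> carrier A" "f (\<one> \<ominus> a \<otimes> b) \<in> J"
      using Units_D_imp_inverse_mod[OF a(1) F.J.zero_closed G.J.zero_closed] by blast
    have "f (\<one> \<ominus> a \<otimes> b) \<oplus>\<^bsub>B\<^esub> f a \<otimes>\<^bsub>B\<^esub> f b \<in> J"
      using b F.J.I_r_closed[OF a(2)] by auto
    moreover have "f (\<one> \<ominus> a \<otimes> b) \<oplus>\<^bsub>B\<^esub> f a \<otimes>\<^bsub>B\<^esub> f b = \<one>\<^bsub>B\<^esub>"
      using b(1) a(1) by (simp add: a_minus_def F.S.a_assoc F.S.l_neg)
    ultimately show False using local_D_imp_proper[OF loc] by simp
  qed
  have sub: "{a \<in> carrier A. f a \<in> J} \<subseteq> ?m" using nonunit unfolding M_eq by auto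
  have max: "maximalideal ?m A"
    unfolding F.R.maximalideal_iff
  proof (intro conjI ballI)
    show "ideal ?m A" using diagonal.ring.ideal_vimage M D.maximalideal_iff by blast
    show "\<one> \<notin> ?m" using D.Units_one_closed unfolding M_eq by (simp add: bi_amalg_simps)
    \<comment> \<open>Outside \<open>?m\<close> the diagonal image is a unit, so \<open>a\<close> is
      invertible modulo the preimage of \<open>J\<close>, which is contained in
      \<open>?m\<close>.\<close>
    fix a assume "a \<in> carrier A - ?m"
    then have a: "a \<in> carrier A" "(f a \<oplus>\<^bsub>B\<^esub> \<zero>\<^bsub>B\<^esub>, g a \<oplus>\<^bsub>C\<^esub> \<zero>\<^bsub>C\<^esub>) \<in> Units D"
      unfolding M_eq by auto
    then obtain b where b: "b \<in> carrier A" "f (\<one> \<ominus> a \<otimes> b) \<in> J"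
      using Units_D_imp_inverse_mod[OF a(1) F.J.zero_closed G.J.zero_closed] by blast
    show "\<exists>b\<in>carrier A. \<one> \<ominus> a \<otimes> b \<in> ?m"
      by (intro bexI[OF _ b(1)] subsetD[OF sub] CollectI conjI b(2)) (use a(1) b(1) in simp)
  qed
  have uniq: "\<mm> = ?m" if m: "maximalideal \<mm> A \<and> {a \<in> carrier A. f a \<in> J} \<subseteq> \<mm>" for \<mm>
  proof -
    have mA: "\<mm> \<subseteq> carrier A" using m ideal.Icarr unfolding F.R.maximalideal_iff by fast
    have "a \<in> \<mm> \<longleftrightarrow> (f a, g a) \<in> M" if "a \<in> carrier A" for a
      using Units_D_iff[OF loc conjunct1[OF m] conjunct2[OF m] that F.J.zero_closed G.J.zero_closed]
        that diagonal.hom_closed[OF that] unfolding M_eq by auto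
    then show ?thesis using mA by blast
  qed
  show ?thesis by (rule ex1I[of _ ?m], rule conjI[OF max sub], erule uniq)
qed

section \<open>The Jacobson radical criterion\<close>

lemma ideals_jacobson_radical_iff:
  "J \<times> J' \<subseteq> jacobson_radical (RDirProd B C) \<longleftrightarrow>
    (\<forall>j\<in>J. \<one>\<^bsub>B\<^esub> \<oplus>\<^bsub>B\<^esub> j \<in> Units B) \<and> (\<forall>j'\<in>J'. \<one>\<^bsub>C\<^esub> \<oplus>\<^bsub>C\<^esub> j' \<in> Units C)"
proof -
  interpret Q: cring "RDirProd B C" using F.S.is_cring G.S.is_cring by (rule RDirProd_cring)
  have U: "(b, c) \<in> Units (RDirProd B C) \<longleftrightarrow> b \<in> Units B \<and> c \<in> Units C" for b c
    unfolding Q.Units_iff F.S.Units_iff G.S.Units_iff by (auto simp: RDirProd_simps)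
  have "ideal (J \<times> J') (RDirProd B C)"
  proof (rule idealI[OF Q.ring_axioms])
    show "subgroup (J \<times> J') (add_monoid (RDirProd B C))"
    proof
      show "inv\<^bsub>add_monoid (RDirProd B C)\<^esub> x \<in> J \<times> J'" if "x \<in> J \<times> J'" for x
        using that F.J.Icarr G.J.Icarr F.J.a_inv_closed G.J.a_inv_closed
        unfolding a_inv_def[symmetric]
        by (auto simp: RDirProd_minus F.S.ring_axioms G.S.ring_axioms)
    qed (use F.J.Icarr G.J.Icarr in \<open>auto simp: RDirProd_simps\<close>)
  qed (auto simp: RDirProd_simps F.J.I_l_closed F.J.I_r_closed G.J.I_l_closed G.J.I_r_closed)
  from Q.ideal_subset_jacobson_radical_iff[OF this]
  have "J \<times> J' \<subseteq> jacobson_radical (RDirProd B C) \<longleftrightarrow>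
      (\<forall>j\<in>J. \<forall>j'\<in>J'. \<one>\<^bsub>B\<^esub> \<oplus>\<^bsub>B\<^esub> j \<in> Units B \<and> \<one>\<^bsub>C\<^esub> \<oplus>\<^bsub>C\<^esub> j' \<in> Units C)"
    by (simp add: RDirProd_simps U)
  \<comment> \<open>Taking \<open>0\<close> in one ideal separates the joint condition into one for
    each factor.\<close>
  then show ?thesis
    using F.J.zero_closed G.J.zero_closed by meson
qed

text \<open>If \<open>D\<close> is local, \<open>J\<close> is a proper ideal of the local ring
  \<open>f(A) + J\<close>, so \<open>1 + J\<close> consists of units. Conversely, units in
  \<open>1 + J\<close> and locality of \<open>A\<close> make \<open>f(A) + J\<close> local. The
  condition on \<open>1 + J'\<close> is already part of \<open>local_D_iff_one_plus\<close>.\<close>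

lemma local_D_iff_jacobson_radical:
  assumes "local_ring A"
  shows "local_ring D \<longleftrightarrow> J \<times> J' \<subseteq> jacobson_radical (RDirProd B C)"
  unfolding ideals_jacobson_radical_iff
proof
  assume loc: "local_ring D"
  then show "(\<forall>j\<in>J. \<one>\<^bsub>B\<^esub> \<oplus>\<^bsub>B\<^esub> j \<in> Units B) \<and> (\<forall>j'\<in>J'. \<one>\<^bsub>C\<^esub> \<oplus>\<^bsub>C\<^esub> j' \<in> Units C)"
    using F.local_image_plus_ideal_one_plus local_D_imp_proper local_D_iff_one_plus by blast
next
  assume "(\<forall>j\<in>J. \<one>\<^bsub>B\<^esub> \<oplus>\<^bsub>B\<^esub> j \<in> Units B) \<and> (\<forall>j'\<in>J'. \<one>\<^bsub>C\<^esub> \<oplus>\<^bsub>C\<^esub> j' \<in> Units C)"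
  then show "local_ring D"
    using F.local_image_plus_ideal[OF assms one_not_zero(1)] local_D_iff_one_plus by blast
qed

end

theorem proposition5p4:
  fixes A :: "('a, 'k) ring_scheme" and B :: "('b, 'm) ring_scheme"
    and C :: "('c, 'n) ring_scheme"
    and f :: "'a \<Rightarrow> 'b" and g :: "'a \<Rightarrow> 'c"
    and J :: "'b set" and J' :: "'c set" and I\<^sub>o :: "'a set"
  assumes "cring A" and "\<one>\<^bsub>A\<^esub> \<noteq> \<zero>\<^bsub>A\<^esub>"
    and "cring B" and "\<one>\<^bsub>B\<^esub> \<noteq> \<zero>\<^bsub>B\<^esub>"
    and "cring C" and "\<one>\<^bsub>C\<^esub> \<noteq> \<zero>\<^bsub>C\<^esub>"
    and "f \<in> ring_hom A B" and "g \<in> ring_hom A C"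
    and "ideal J B" and "ideal J' C"
    and "I\<^sub>o = {a \<in> carrier A. f a \<in> J}"
    and "I\<^sub>o = {a \<in> carrier A. g a \<in> J'}"
  shows "(local_ring (bi_amalg A B C f g J J') \<longleftrightarrow>
            J \<noteq> carrier B \<and> local_ring (image_plus_ideal A B f J)
              \<and> local_ring (image_plus_ideal A C g J'))
       \<and> (local_ring (bi_amalg A B C f g J J') \<longrightarrow>
            (\<exists>!\<mm>. maximalideal \<mm> A \<and> I\<^sub>o \<subseteq> \<mm>)
            \<and> (\<forall>\<mm> M. maximalideal \<mm> A \<and> I\<^sub>o \<subseteq> \<mm>
                  \<and> maximalideal M (bi_amalg A B C f g J J')
                \<longrightarrow> M = bi_amalg_set B C f g J J' \<mm>))
       \<and> (local_ring A \<longrightarrow>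
            (local_ring (bi_amalg A B C f g J J') \<longleftrightarrow>
              J \<times> J' \<subseteq> jacobson_radical (RDirProd B C)))"
proof -
  have f: "ring_hom_cring A B f" and g: "ring_hom_cring A C g"
    using assms(1,3,5,7,8) by (intro ring_hom_cring.intro ring_hom_cring_axioms.intro; blast)+
  have same: "f a \<in> J \<longleftrightarrow> g a \<in> J'" if "a \<in> carrier A" for a
    using assms(11,12) that by blast
  interpret bi_amalgamation A B C f g J J'
    using same assms(4,6,9,10)
    by (intro bi_amalgamation.intro hom_to_ideal.intro f g
        hom_to_ideal_axioms.intro bi_amalgamation_axioms.intro)
  show ?thesis
    unfolding assms(11)
  proof (intro conjI impI allI)
    show "local_ring D \<longleftrightarrow> J \<noteq> carrier B \<and> local_ring F.P \<and> local_ring G.P"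
      by (rule local_D_iff)
  next
    assume loc: "local_ring D"
    show "\<exists>!\<mm>. maximalideal \<mm> A \<and> {a \<in> carrier A. f a \<in> J} \<subseteq> \<mm>"
      using loc by (rule maximalideal_over_preimage)
    fix \<mm> M
    assume "maximalideal \<mm> A \<and> {a \<in> carrier A. f a \<in> J} \<subseteq> \<mm> \<and> maximalideal M D"
    then show "M = bi_amalg_set B C f g J J' \<mm>" using maximalideal_D_eq[OF loc] by simp
  next
    assume "local_ring A"
    then show "local_ring D \<longleftrightarrow> J \<times> J' \<subseteq> jacobson_radical (RDirProd B C)"
      by (rule local_D_iff_jacobson_radical)
  qed
qed

end
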